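(* Let $\mathcal{V}$ be a $d$-dimensional linear subspace of $\mathbb{R}^m$ equipped with the scalar product $(x,y)_A=\langle x,Ay\rangle$, where $A$ is a diagonal positive $m\times m$-matrix. Let $c:[0,\infty)\to\mathcal{V}$ be Lipschitz continuous and let $F\subset C\subset\mathcal{V}$ be nonempty closed convex sets. Assume that there exists $\varepsilon>0$ such that $$-\dot c(t)+B^A_\varepsilon(0)\cap N^A_F(y)\subset N^A_C(y)\quad\text{for all } y\in F \text{ and almost all } t\in[0,\tau_d],$$ where $$\tau_d\ge\frac1\varepsilon\cdot\max_{v_1\in C,\ v_2\in F}\|v_1-v_2\|^A$$ (the maximum being assumed to exist). Then every solution $y$ of the sweeping process $$-\dot y(t)\in N^A_{C(t)}(y(t)),\qquad C(t)=C+c(t),$$ with any initial condition $y(0)\in C(0)$ satisfies $y(\tau_d)\in F+c(\tau_d)$.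
   Context: $\langle\cdot,\cdot\rangle$ is the Euclidean scalar product of $\mathbb{R}^m$; $\|x\|^A=\sqrt{\langle x,Ax\rangle}$; $B^A_\varepsilon(0)=\{x\in\mathcal{V}:\|x\|^A\le\varepsilon\}$. For a closed convex set $K\subset\mathcal{V}$ the normal cone is $N^A_K(y)=\{x\in\mathcal{V}:\langle x,A(\xi-y)\rangle\le 0\ \text{for all }\xi\in K\}$ if $y\in K$, and $N^A_K(y)=\emptyset$ if $y\notin K$. For a set $K$ and a vector $v$, $v+K=\{v+k:k\in K\}$. A solution of the sweeping process is a locally absolutely continuous function $y:[0,\infty)\to\mathcal{V}$ with $y(t)\in C(t)$ for all $t\ge0$ that satisfies the inclusion for almost every $t\ge 0$. *)

theory Defs
  imports "HOL-Analysis.Analysis"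
begin

definition norm_wrt :: "real^'m^'m \<Rightarrow> real^'m \<Rightarrow> real" where
  "norm_wrt A x = sqrt (x \<bullet> (A *v x))"

definition ball_wrt :: "(real^'m) set \<Rightarrow> real^'m^'m \<Rightarrow> real \<Rightarrow> (real^'m) set" where
  "ball_wrt V A \<epsilon> = {x \<in> V. norm_wrt A x \<le> \<epsilon>}"

definition normal_cone ::
    "(real^'m) set \<Rightarrow> real^'m^'m \<Rightarrow> (real^'m) set \<Rightarrow> real^'m \<Rightarrow> (real^'m) set" where
  "normal_cone V A K y =
     (if y \<in> K then {x \<in> V. \<forall>\<xi>\<in>K. x \<bullet> (A *v (\<xi> - y)) \<le> 0} else {})"

definition abs_continuous_on :: "real set \<Rightarrow> (real \<Rightarrow> 'a::real_normed_vector) \<Rightarrow> bool" where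
  "abs_continuous_on I f \<longleftrightarrow>
     (\<forall>e>0. \<exists>\<delta>>0. \<forall>S :: (real \<times> real) set.
        finite S \<and> (\<forall>(a, b)\<in>S. a \<le> b \<and> {a..b} \<subseteq> I) \<and>
        pairwise (\<lambda>(a, b) (a', b'). {a<..<b} \<inter> {a'<..<b'} = {}) S \<and>
        (\<Sum>(a, b)\<in>S. b - a) < \<delta>
        \<longrightarrow> (\<Sum>(a, b)\<in>S. norm (f b - f a)) < e)"

definition locally_abs_continuous :: "(real \<Rightarrow> 'a::real_normed_vector) \<Rightarrow> bool" where
  "locally_abs_continuous f \<longleftrightarrow> (\<forall>T\<ge>0. abs_continuous_on {0..T} f)"

text \<open>
  Functions on \<open>[0,\<infinity>)\<close> are represented by total functions on the reals whose values at
  negative arguments are irrelevant; derivatives are therefore taken within \<open>{0..}\<close>.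
  That the inclusion \<open>- y'(t) \<in> N\<close> holds at \<open>t\<close> includes the existence of \<open>y'(t)\<close>.
\<close>

definition sweeping_solution ::
    "(real^'m) set \<Rightarrow> real^'m^'m \<Rightarrow> (real \<Rightarrow> (real^'m) set) \<Rightarrow> (real \<Rightarrow> real^'m) \<Rightarrow> bool" where
  "sweeping_solution V A C y \<longleftrightarrow>
     (\<forall>t\<ge>0. y t \<in> V) \<and> locally_abs_continuous y \<and> (\<forall>t\<ge>0. y t \<in> C t) \<and>
     (AE t\<in>{0..} in lebesgue. \<exists>y'. (y has_vector_derivative y') (at t within {0..}) \<and>
        - y' \<in> normal_cone V A (C t) (y t))"

end

theory Submission
  imports Defs
begin

text \<open>
  Let \<open>D t\<close> be the distance in \<open>\<parallel>\<cdot>\<parallel>\<^sup>A\<close> from \<open>y t - c t \<in> C\<close> to \<open>F\<close>, and \<open>u\<close> the vector from the nearest point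
  \<open>z \<in> F\<close> to \<open>y t - c t\<close>. Since \<open>u\<close> lies in the normal cone of \<open>F\<close> at \<open>z\<close>, the hypothesis puts
  \<open>- c' t + (\<epsilon> / D t) u\<close> in the normal cone of \<open>C\<close> at \<open>z\<close>; testing it against \<open>y t - c t\<close>, and the
  sweeping inclusion against \<open>z + c t\<close>, gives \<open>D' \<le> - \<epsilon>\<close> almost everywhere on \<open>{D > 0}\<close>. As \<open>D\<close> is
  absolutely continuous and \<open>D 0 \<le> \<epsilon> \<tau>\<close>, it vanishes at time \<open>\<tau>\<close>. The derivative of \<open>c\<close> exists almost
  everywhere by Rademacher's theorem in one variable, which follows from Vitali's covering theorem.
\<close>

section \<open>Absolutely continuous functions\<close>

lemma abs_continuous_on_subset:
  assumes "abs_continuous_on I f" "J \<subseteq> I"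
  shows "abs_continuous_on J f"
  unfolding abs_continuous_on_def
proof (intro allI impI)
  fix e :: real assume "e > 0"
  then obtain \<delta> where "\<delta> > 0" and \<delta>: "\<And>S :: (real \<times> real) set.
        finite S \<and> (\<forall>(a, b)\<in>S. a \<le> b \<and> {a..b} \<subseteq> I) \<and>
        pairwise (\<lambda>(a, b) (a', b'). {a<..<b} \<inter> {a'<..<b'} = {}) S \<and>
        (\<Sum>(a, b)\<in>S. b - a) < \<delta> \<Longrightarrow> (\<Sum>(a, b)\<in>S. norm (f b - f a)) < e"
    using assms(1) unfolding abs_continuous_on_def by meson
  show "\<exists>\<delta>>0. \<forall>S :: (real \<times> real) set.
        finite S \<and> (\<forall>(a, b)\<in>S. a \<le> b \<and> {a..b} \<subseteq> J) \<and>
        pairwise (\<lambda>(a, b) (a', b'). {a<..<b} \<inter> {a'<..<b'} = {}) S \<and>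
        (\<Sum>(a, b)\<in>S. b - a) < \<delta> \<longrightarrow> (\<Sum>(a, b)\<in>S. norm (f b - f a)) < e"
    by (rule exI [of _ \<delta>]) (use \<open>\<delta> > 0\<close> \<delta> assms(2) in \<open>fastforce simp: case_prod_unfold\<close>)
qed

lemma abs_continuous_on_imp_continuous_on:
  assumes "abs_continuous_on {a..b} f"
  shows "continuous_on {a..b} f"
  unfolding continuous_on_iff
proof (intro ballI allI impI)
  fix x e :: real assume x: "x \<in> {a..b}" and "e > 0"
  then obtain \<delta> where "\<delta> > 0" and \<delta>: "\<And>S :: (real \<times> real) set.
        finite S \<Longrightarrow> (\<forall>(a', b')\<in>S. a' \<le> b' \<and> {a'..b'} \<subseteq> {a..b}) \<Longrightarrow>
        pairwise (\<lambda>(a, b) (a', b'). {a<..<b} \<inter> {a'<..<b'} = {}) S \<Longrightarrow>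
        (\<Sum>(a, b)\<in>S. b - a) < \<delta> \<Longrightarrow> (\<Sum>(a, b)\<in>S. norm (f b - f a)) < e"
    using assms unfolding abs_continuous_on_def by meson
  have "dist (f y) (f x) < e" if y: "y \<in> {a..b}" "dist y x < \<delta>" for y
    using \<delta> [of "{(x, y)}"] \<delta> [of "{(y, x)}"] x y
    by (cases "x \<le> y") (auto simp: dist_norm norm_minus_commute)
  then show "\<exists>d>0. \<forall>x'\<in>{a..b}. dist x' x < d \<longrightarrow> dist (f x') (f x) < e"
    using \<open>\<delta> > 0\<close> by blast
qed

text \<open>Summed over a family of short disjoint intervals, the first term of the bound is small
  by absolute continuity of \<open>f\<close> and the second by the small total length. It will
  transfer absolute continuity from the solution to the distance function.\<close>

lemma abs_continuous_on_dominated: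
  fixes f :: "real \<Rightarrow> 'a::real_normed_vector" and h :: "real \<Rightarrow> 'b::real_normed_vector"
  assumes f: "abs_continuous_on I f" and KL: "K \<ge> 0" "L \<ge> 0"
    and dom: "\<And>a b. a \<in> I \<Longrightarrow> b \<in> I \<Longrightarrow> a \<le> b \<Longrightarrow> norm (h b - h a) \<le> K * norm (f b - f a) + L * (b - a)"
  shows "abs_continuous_on I h"
  unfolding abs_continuous_on_def
proof (intro allI impI)
  fix e :: real assume "e > 0"
  \<comment> \<open>Each of the two terms gets the share \<open>e / 2\<close>. Dividing by
    \<open>K + 1\<close> and \<open>L + 1\<close> instead of \<open>K\<close> and \<open>L\<close>
    covers vanishing constants.\<close>
  then have "e / (2 * (K + 1)) > 0" using KL by simp
  then obtain \<delta> where "\<delta> > 0" and \<delta>: "\<And>S :: (real \<times> real) set.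
        finite S \<and> (\<forall>(a, b)\<in>S. a \<le> b \<and> {a..b} \<subseteq> I) \<and>
        pairwise (\<lambda>(a, b) (a', b'). {a<..<b} \<inter> {a'<..<b'} = {}) S \<and>
        (\<Sum>(a, b)\<in>S. b - a) < \<delta> \<Longrightarrow> (\<Sum>(a, b)\<in>S. norm (f b - f a)) < e / (2 * (K + 1))"
    using f unfolding abs_continuous_on_def by meson
  show "\<exists>\<delta>>0. \<forall>S :: (real \<times> real) set.
        finite S \<and> (\<forall>(a, b)\<in>S. a \<le> b \<and> {a..b} \<subseteq> I) \<and>
        pairwise (\<lambda>(a, b) (a', b'). {a<..<b} \<inter> {a'<..<b'} = {}) S \<and>
        (\<Sum>(a, b)\<in>S. b - a) < \<delta> \<longrightarrow> (\<Sum>(a, b)\<in>S. norm (h b - h a)) < e"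
  proof (rule exI [of _ "min \<delta> (e / (2 * (L + 1)))"], intro conjI allI impI)
    show "min \<delta> (e / (2 * (L + 1))) > 0" using \<open>\<delta> > 0\<close> \<open>e > 0\<close> KL by simp
    fix S :: "(real \<times> real) set"
    assume S: "finite S \<and> (\<forall>(a, b)\<in>S. a \<le> b \<and> {a..b} \<subseteq> I) \<and>
        pairwise (\<lambda>(a, b) (a', b'). {a<..<b} \<inter> {a'<..<b'} = {}) S \<and>
        (\<Sum>(a, b)\<in>S. b - a) < min \<delta> (e / (2 * (L + 1)))"
    let ?f = "\<Sum>(a, b)\<in>S. norm (f b - f a)" and ?l = "\<Sum>(a, b)\<in>S. b - a"
    have "?f < e / (2 * (K + 1))" using S by (intro \<delta>) simp
    have "0 \<le> ?f" by (rule sum_nonneg) auto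
    have 2: "0 \<le> ?l" "?l < e / (2 * (L + 1))"
      using S by (auto intro!: sum_nonneg)
    have "(\<Sum>(a, b)\<in>S. norm (h b - h a)) \<le> (\<Sum>(a, b)\<in>S. K * norm (f b - f a) + L * (b - a))"
    proof (rule sum_mono, clarify)
      fix a b assume "(a, b) \<in> S"
      then have "a \<le> b" "{a..b} \<subseteq> I" using S by auto
      then show "norm (h b - h a) \<le> K * norm (f b - f a) + L * (b - a)"
        by (intro dom) auto
    qed
    also have "\<dots> = K * ?f + L * ?l"
      by (simp add: sum.distrib sum_distrib_left case_prod_unfold)
    also have "\<dots> < e"
    proof -
      have "K * ?f \<le> (K + 1) * ?f" "L * ?l \<le> (L + 1) * ?l"
        using \<open>0 \<le> ?f\<close> 2 by (simp_all add: algebra_simps)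
      moreover have "(K + 1) * ?f < e / 2" "(L + 1) * ?l < e / 2"
        using \<open>?f < e / (2 * (K + 1))\<close> 2 KL by (simp_all add: field_simps)
      ultimately show ?thesis by linarith
    qed
    finally show "(\<Sum>(a, b)\<in>S. norm (h b - h a)) < e" .
  qed
qed

text \<open>A gauge argument in the manner of Henstock. Around a tag outside \<open>N\<close> the
  derivative bounds the increment over a small interval; the intervals tagged in \<open>N\<close>
  lie in an open set of small measure, where absolute continuity makes the sum of increments
  small.\<close>

lemma abs_continuous_on_increment_le:
  fixes f :: "real \<Rightarrow> real"
  assumes "a \<le> b" and ac: "abs_continuous_on {a..b} f" and N: "negligible N"
    and der: "\<And>t. t \<in> {a..b} - N \<Longrightarrow> \<exists>f'. (f has_real_derivative f') (at t) \<and> f' \<le> k"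
  shows "f b - f a \<le> k * (b - a)"
proof (rule field_le_epsilon)
  fix e0 :: real assume "e0 > 0"
  \<comment> \<open>There are three errors: \<open>e * (b - a)\<close> from the differentiability
    estimates, \<open>e\<close> from the increments at tags in \<open>N\<close>, and
    \<open>e\<close> from the length missing at those tags. They add up to
    \<open>e0\<close>.\<close>
  define e where "e = e0 / (b - a + 2)"
  have "e > 0" using \<open>e0 > 0\<close> \<open>a \<le> b\<close> by (simp add: e_def)
  have e0: "e * (b - a + 2) = e0" using \<open>a \<le> b\<close> by (simp add: e_def)
  obtain \<delta> where "\<delta> > 0" and \<delta>: "\<And>S :: (real \<times> real) set.
        finite S \<Longrightarrow> (\<forall>(a', b')\<in>S. a' \<le> b' \<and> {a'..b'} \<subseteq> {a..b}) \<Longrightarrow>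
        pairwise (\<lambda>(a, b) (a', b'). {a<..<b} \<inter> {a'<..<b'} = {}) S \<Longrightarrow>
        (\<Sum>(a, b)\<in>S. b - a) < \<delta> \<Longrightarrow> (\<Sum>(a, b)\<in>S. norm (f b - f a)) < e"
    using ac \<open>e > 0\<close> unfolding abs_continuous_on_def by meson
  \<comment> \<open>The bound \<delta> serves absolute continuity; the other one makes a missing
    length below \<eta> cost at most \<open>e\<close> after multiplication by
    \<open>\<bar>k\<bar>\<close>.\<close>
  define \<eta> where "\<eta> = min \<delta> (e / (\<bar>k\<bar> + 1))"
  have "\<eta> > 0" using \<open>\<delta> > 0\<close> \<open>e > 0\<close> by (simp add: \<eta>_def)
  have "N \<in> null_sets lebesgue" using N by (simp add: negligible_iff_null_sets)
  then have Nset: "N \<in> sets lebesgue" by auto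
  \<comment> \<open>Outer regularity: since \<open>N\<close> is null, \<open>G\<close> itself has
    measure below \<eta>.\<close>
  obtain G where G: "open G" "N \<subseteq> G" "G - N \<in> lmeasurable" "emeasure lebesgue (G - N) < ennreal \<eta>"
    using sets_lebesgue_outer_open [OF Nset \<open>\<eta> > 0\<close>] by blast
  have GU: "G = (G - N) \<union> N" using G by auto
  have Gm: "G \<in> lmeasurable"
    by (subst GU) (intro fmeasurable.Un G negligible_imp_measurable N)
  have "measure lebesgue G = measure lebesgue (G - N)"
    by (rule measure_negligible_symdiff [symmetric])
      (use Gm G N negligible_subset in \<open>auto intro: negligible_subset\<close>)
  then have G\<eta>: "measure lebesgue G < \<eta>"
    using G(3,4) \<open>\<eta> > 0\<close> by (metis emeasure_eq_measure2 ennreal_less_iff measure_nonneg)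
  \<comment> \<open>The straddle lemma: because \<open>u \<le> t \<le> v\<close>, the errors at
    \<open>u\<close> and at \<open>v\<close> add up to \<open>e * (v - u)\<close>, a multiple of the
    length of the interval.\<close>
  have "\<exists>d>0. \<forall>u v. u \<le> t \<longrightarrow> t \<le> v \<longrightarrow> {u..v} \<subseteq> ball t d \<longrightarrow> f v - f u \<le> (k + e) * (v - u)"
    if t: "t \<in> {a..b} - N" for t
  proof -
    obtain f' where f': "(f has_real_derivative f') (at t)" "f' \<le> k" using der [OF t] by blast
    then obtain d where "d > 0" and d: "\<And>y. \<bar>y - t\<bar> < d \<Longrightarrow> \<bar>f y - f t - f' * (y - t)\<bar> \<le> e * \<bar>y - t\<bar>"
      using \<open>e > 0\<close> unfolding has_field_derivative_def has_derivative_at_alt by (metis real_norm_def)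
    show ?thesis
    proof (intro exI conjI allI impI)
      fix u v assume uv: "u \<le> t" "t \<le> v" "{u..v} \<subseteq> ball t d"
      then have "u \<in> ball t d" "v \<in> ball t d" by (auto intro!: subsetD [OF uv(3)] simp del: mem_ball)
      then have "\<bar>u - t\<bar> < d" "\<bar>v - t\<bar> < d" by (auto simp: dist_real_def)
      from d [OF this(1)] d [OF this(2)] uv
      have "f v - f u \<le> f' * (v - u) + e * (v - u)" by (simp add: algebra_simps)
      also have "\<dots> \<le> k * (v - u) + e * (v - u)"
        using uv f' by (intro add_right_mono mult_right_mono) auto
      finally show "f v - f u \<le> (k + e) * (v - u)" by (simp add: algebra_simps)
    qed (fact \<open>d > 0\<close>)
  qed
  then obtain d where d0: "\<And>t. t \<in> {a..b} - N \<Longrightarrow> d t > 0"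
    and d: "\<And>t u v. t \<in> {a..b} - N \<Longrightarrow> u \<le> t \<Longrightarrow> t \<le> v \<Longrightarrow> {u..v} \<subseteq> ball t (d t) \<Longrightarrow>
       f v - f u \<le> (k + e) * (v - u)" by metis
  \<comment> \<open>A division of \<open>{a..b}\<close> has no tag outside \<open>{a..b}\<close>;
    the last branch only makes \<gamma> a gauge on the whole line.\<close>
  define \<gamma> where "\<gamma> t = (if t \<in> N then G else if t \<in> {a..b} then ball t (d t) else ball t 1)" for t
  have "gauge \<gamma>"
    using G d0 by (auto simp: gauge_def \<gamma>_def)
  then obtain p where p: "p tagged_division_of {a..b}" "\<gamma> fine p"
    using fine_division_exists_real by blast
  note pD = tagged_division_ofD [OF p(1)]
  \<comment> \<open>Every piece is the interval between its infimum and supremum. This turns the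
    tagged division into the endpoint pairs used by absolute continuity.\<close>
  have K: "{Inf K..Sup K} = K" "Inf K \<le> x" "x \<le> Sup K" "x \<in> {a..b}" "{Inf K..Sup K} \<subseteq> {a..b}"
     "K \<subseteq> \<gamma> x" if xK: "(x, K) \<in> p" for x K
  proof -
    obtain c c' where cd: "K = {c..c'}" using pD(4) [OF xK] by (auto simp: box_real)
    moreover have "x \<in> K" using pD(2) [OF xK] .
    ultimately show *: "{Inf K..Sup K} = K" "Inf K \<le> x" "x \<le> Sup K" by auto
    then show "x \<in> {a..b}" "{Inf K..Sup K} \<subseteq> {a..b}" using \<open>x \<in> K\<close> pD(3) [OF xK] by blast+
    show "K \<subseteq> \<gamma> x" using p(2) xK by (auto simp: fine_def)
  qed
  have le: "Inf K \<le> Sup K" if "(x, K) \<in> p" for x K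
    using K(2,3) [OF that] by linarith
  define P where "P = {z \<in> p. fst z \<in> N}"
  have "finite P" "P \<subseteq> p" using pD(1) by (auto simp: P_def)
  have disj: "{Inf K<..<Sup K} \<inter> {Inf K'<..<Sup K'} = {}"
    if "(x, K) \<in> p" "(x', K') \<in> p" "(x, K) \<noteq> (x', K')" for x K x' K'
  proof -
    have "interior K = {Inf K<..<Sup K}" if "(x, K) \<in> p" for x K
      by (subst K(1) [OF that, symmetric]) (simp only: interior_atLeastAtMost_real)
    then have "interior K = {Inf K<..<Sup K}" "interior K' = {Inf K'<..<Sup K'}"
      using that by blast+
    then show ?thesis using pD(5) [OF that] by simp
  qed
  \<comment> \<open>The open intervals of the pieces tagged in \<open>N\<close> are disjoint and lie
    in \<open>G\<close> by fineness, so their total length is at most the measure of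
    \<open>G\<close>.\<close>
  have len: "(\<Sum>(x,K)\<in>P. Sup K - Inf K) < \<eta>"
  proof -
    have "(\<Sum>(x,K)\<in>P. Sup K - Inf K) = (\<Sum>z\<in>P. measure lebesgue {Inf (snd z)<..<Sup (snd z)})"
    proof (intro sum.cong refl, clarify)
      fix x K assume "(x, K) \<in> P"
      then have "(x, K) \<in> p" using \<open>P \<subseteq> p\<close> by auto
      then have "Inf K \<le> Sup K" by (rule le)
      then show "Sup K - Inf K = measure lebesgue {Inf (snd (x, K))<..<Sup (snd (x, K))}" by simp
    qed
    also have "\<dots> = measure lebesgue (\<Union>z\<in>P. {Inf (snd z)<..<Sup (snd z)})"
    proof (rule measure_negligible_finite_Union_image [symmetric])
      show "pairwise (\<lambda>z z'. negligible ({Inf (snd z)<..<Sup (snd z)} \<inter> {Inf (snd z')<..<Sup (snd z')})) P"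
      proof (rule pairwiseI)
        fix z z' assume "z \<in> P" "z' \<in> P" "z \<noteq> z'"
        then have "{Inf (snd z)<..<Sup (snd z)} \<inter> {Inf (snd z')<..<Sup (snd z')} = {}"
          using \<open>P \<subseteq> p\<close> by (intro disj [of "fst z" _ "fst z'"]) (auto simp: prod_eq_iff)
        then show "negligible ({Inf (snd z)<..<Sup (snd z)} \<inter> {Inf (snd z')<..<Sup (snd z')})"
          by (simp only: negligible_empty)
      qed
    qed (simp_all add: \<open>finite P\<close>)
    also have "\<dots> \<le> measure lebesgue G"
    proof (rule measure_mono_fmeasurable)
      show "(\<Union>z\<in>P. {Inf (snd z)<..<Sup (snd z)}) \<subseteq> G"
      proof
        fix t assume "t \<in> (\<Union>z\<in>P. {Inf (snd z)<..<Sup (snd z)})"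
        then obtain x K where xK: "(x, K) \<in> P" and t: "Inf K < t" "t < Sup K" by auto
        then have "(x, K) \<in> p" "x \<in> N" by (simp_all add: P_def)
        have "t \<in> {Inf K..Sup K}" using t by simp
        then have "t \<in> K" using K(1) [OF \<open>(x, K) \<in> p\<close>] by blast
        then have "t \<in> \<gamma> x" using K(6) [OF \<open>(x, K) \<in> p\<close>] by blast
        then show "t \<in> G" using \<open>x \<in> N\<close> by (simp add: \<gamma>_def)
      qed
      show "(\<Union>z\<in>P. {Inf (snd z)<..<Sup (snd z)}) \<in> sets lebesgue"
        by (intro sets.finite_UN \<open>finite P\<close>) simp
    qed (rule Gm)
    finally show ?thesis using G\<eta> by linarith
  qed
  let ?I = "\<lambda>(x::real, K::real set). (Inf K, Sup K)"
  \<comment> \<open>Passing from tagged pieces to endpoint pairs can identify two pieces, but only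
    degenerate ones, as interiors are disjoint. Sums of a function vanishing on
    \<open>(u, u)\<close> are therefore unchanged.\<close>
  have inj: "Inf K = Sup K"
    if "(x, K) \<in> P" "(x', K') \<in> P" "(x, K) \<noteq> (x', K')" "Inf K = Inf K'" "Sup K = Sup K'" for x K x' K'
  proof -
    have *: "(x, K) \<in> p" "(x', K') \<in> p" using that \<open>P \<subseteq> p\<close> by auto
    then have "{Inf K<..<Sup K} = {}" using disj [OF * that(3)] that by auto
    moreover have "Inf K \<le> Sup K" using le [OF *(1)] .
    ultimately show ?thesis by simp
  qed
  have PI: "(\<Sum>z\<in>?I ` P. h z) = (\<Sum>(x,K)\<in>P. h (Inf K, Sup K))"
    if h0: "\<And>u. h (u, u) = 0" for h :: "real \<times> real \<Rightarrow> real"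
  proof -
    have "sum h (?I ` P) = sum (h \<circ> ?I) P"
    proof (rule sum.reindex_nontrivial [OF \<open>finite P\<close>])
      fix z z' assume z: "z \<in> P" "z' \<in> P" "z \<noteq> z'" "?I z = ?I z'"
      obtain x K x' K' where zz: "z = (x, K)" "z' = (x', K')" by (metis prod.collapse)
      then have "Inf K = Sup K" using inj [of x K x' K'] z by simp
      then show "h (?I z) = 0" using h0 by (simp add: zz)
    qed
    then show ?thesis by (simp add: comp_def case_prod_unfold)
  qed
  have "(\<Sum>(u, v)\<in>?I ` P. norm (f v - f u)) < e"
  proof (rule \<delta>)
    show "finite (?I ` P)" using \<open>finite P\<close> by simp
    show "\<forall>(a', b')\<in>?I ` P. a' \<le> b' \<and> {a'..b'} \<subseteq> {a..b}"
    proof (intro ballI, clarify, intro conjI)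
      fix x K assume "(x, K) \<in> P"
      then have xK: "(x, K) \<in> p" using \<open>P \<subseteq> p\<close> by blast
      show "Inf K \<le> Sup K" "{Inf K..Sup K} \<subseteq> {a..b}" using le [OF xK] K(5) [OF xK] by blast+
    qed
    show "pairwise (\<lambda>(a, b) (a', b'). {a<..<b} \<inter> {a'<..<b'} = {}) (?I ` P)"
    proof (rule pairwiseI)
      fix z z' assume "z \<in> ?I ` P" "z' \<in> ?I ` P" "z \<noteq> z'"
      then obtain x K x' K' where *: "(x, K) \<in> P" "(x', K') \<in> P"
        "z = (Inf K, Sup K)" "z' = (Inf K', Sup K')" by auto
      with \<open>z \<noteq> z'\<close> have "(x, K) \<noteq> (x', K')" by auto
      then have "{Inf K<..<Sup K} \<inter> {Inf K'<..<Sup K'} = {}"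
        using * \<open>P \<subseteq> p\<close> by (intro disj) auto
      then show "(case z of (a, b) \<Rightarrow> \<lambda>(a', b'). {a<..<b} \<inter> {a'<..<b'} = {}) z'"
        using * by simp
    qed
    show "(\<Sum>(a, b)\<in>?I ` P. b - a) < \<delta>"
      using len by (subst PI) (simp_all add: \<eta>_def)
  qed
  then have "(\<Sum>(x,K)\<in>P. norm (f (Sup K) - f (Inf K))) < e" by (subst (asm) PI) auto
  moreover have "(\<Sum>(x,K)\<in>P. f (Sup K) - f (Inf K)) \<le> (\<Sum>(x,K)\<in>P. norm (f (Sup K) - f (Inf K)))"
    by (rule sum_mono) auto
  ultimately have I: "(\<Sum>(x,K)\<in>P. f (Sup K) - f (Inf K)) < e" by linarith
  have II: "(\<Sum>(x,K)\<in>p-P. f (Sup K) - f (Inf K)) \<le> (\<Sum>(x,K)\<in>p-P. (k + e) * (Sup K - Inf K))"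
  proof (rule sum_mono, clarify)
    fix x K assume xK: "(x, K) \<in> p" "(x, K) \<notin> P"
    then have "x \<notin> N" by (simp add: P_def)
    then have "\<gamma> x = ball x (d x)" using K(4) [OF xK(1)] by (simp add: \<gamma>_def)
    then have "{Inf K..Sup K} \<subseteq> ball x (d x)" using K(1,6) [OF xK(1)] by simp
    then show "f (Sup K) - f (Inf K) \<le> (k + e) * (Sup K - Inf K)"
      using K(2-4) [OF xK(1)] \<open>x \<notin> N\<close> by (intro d [of x]) blast+
  qed
  have split: "(\<Sum>(x,K)\<in>p. h (Sup K) - h (Inf K)) =
      (\<Sum>(x,K)\<in>p-P. h (Sup K) - h (Inf K)) + (\<Sum>(x,K)\<in>P. h (Sup K) - h (Inf K))"
    for h :: "real \<Rightarrow> real"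
    by (rule sum.subset_diff [OF \<open>P \<subseteq> p\<close> pD(1)])
  define l where "l = (\<Sum>(x,K)\<in>P. Sup K - Inf K)"
  have "0 \<le> l" unfolding l_def
    using le \<open>P \<subseteq> p\<close> by (intro sum_nonneg) auto
  have L: "(\<Sum>(x,K)\<in>p-P. Sup K - Inf K) = b - a - l"
    using split [of "\<lambda>x. x"] additive_tagged_division_1 [OF \<open>a \<le> b\<close> p(1), of "\<lambda>x. x"]
    by (simp add: l_def)
  have "f b - f a = (\<Sum>(x,K)\<in>p-P. f (Sup K) - f (Inf K)) + (\<Sum>(x,K)\<in>P. f (Sup K) - f (Inf K))"
    using split [of f] additive_tagged_division_1 [OF \<open>a \<le> b\<close> p(1), of f] by simp
  also have "\<dots> \<le> (\<Sum>(x,K)\<in>p-P. (k + e) * (Sup K - Inf K)) + e"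
    using I II by linarith
  also have "(\<Sum>(x,K)\<in>p-P. (k + e) * (Sup K - Inf K)) = (k + e) * (b - a - l)"
    by (simp add: L [symmetric] sum_distrib_left case_prod_unfold)
  \<comment> \<open>The sign of \<open>k\<close> is arbitrary, so the missing length
    \<open>l\<close> enters through \<open>\<bar>k\<bar> * l\<close>.\<close>
  also have "(k + e) * (b - a - l) + e \<le> k * (b - a) + e * (b - a) + e + \<bar>k\<bar> * l"
  proof -
    have "- (k * l) \<le> \<bar>k\<bar> * l" using \<open>0 \<le> l\<close> by (metis abs_ge_minus_self mult_minus_left mult_right_mono)
    moreover have "0 \<le> e * l" using \<open>0 \<le> l\<close> \<open>e > 0\<close> by simp
    ultimately show ?thesis by (simp add: algebra_simps)
  qed
  also have "\<bar>k\<bar> * l \<le> e"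
  proof -
    have "\<bar>k\<bar> * l \<le> (\<bar>k\<bar> + 1) * \<eta>"
      using len \<open>0 \<le> l\<close> \<open>\<eta> > 0\<close> by (intro mult_mono) (auto simp: l_def)
    also have "\<dots> \<le> (\<bar>k\<bar> + 1) * (e / (\<bar>k\<bar> + 1))"
      by (intro mult_left_mono) (auto simp: \<eta>_def)
    finally show ?thesis by simp
  qed
  finally show "f b - f a \<le> k * (b - a) + e0"
    by (simp add: e0 [symmetric] algebra_simps)
qed

text \<open>After its last zero in \<open>{0..\<tau>}\<close>, \<open>D\<close> decreases at rate at
  least \<epsilon>, so it cannot end above zero. If there is no zero, the decrease from time 0 on
  already uses up the initial value, which is at most \<open>\<epsilon> * \<tau>\<close>.\<close>

lemma vanishes_by_decay:
  fixes D :: "real \<Rightarrow> real"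
  assumes ac: "abs_continuous_on {0..\<tau>} D" and N: "negligible N" and "\<epsilon> > 0" "\<tau> \<ge> 0"
    and nonneg: "\<And>t. D t \<ge> 0" and D0: "D 0 \<le> \<epsilon> * \<tau>"
    and der: "\<And>t. t \<in> {0..\<tau>} - N \<Longrightarrow> D t > 0 \<Longrightarrow> \<exists>f'. (D has_real_derivative f') (at t) \<and> f' \<le> - \<epsilon>"
  shows "D \<tau> = 0"
proof -
  define Z where "Z = {0..\<tau>} \<inter> D -` {0}"
  have decay: "D \<tau> \<le> D s - \<epsilon> * (\<tau> - s)" if s: "s \<in> {0..\<tau>}" "\<And>t. t \<in> {s<..\<tau>} \<Longrightarrow> D t \<noteq> 0" for s
  proof -
    have "D \<tau> - D s \<le> - \<epsilon> * (\<tau> - s)"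
    proof (rule abs_continuous_on_increment_le)
      show "abs_continuous_on {s..\<tau>} D" using ac by (rule abs_continuous_on_subset) (use s in auto)
      \<comment> \<open>The left endpoint joins the exceptional set because \<open>D\<close> may
        vanish there, and then \<open>der\<close> says nothing.\<close>
      show "negligible (insert s N)" using N by simp
      fix t assume "t \<in> {s..\<tau>} - insert s N"
      then have "t \<in> {0..\<tau>} - N" "t \<in> {s<..\<tau>}" using s(1) by auto
      moreover from this have "D t > 0" using s(2) [of t] nonneg [of t] by simp
      ultimately show "\<exists>f'. (D has_real_derivative f') (at t) \<and> f' \<le> - \<epsilon>" by (intro der)
    qed (use s in auto)
    then show ?thesis by simp
  qed
  show ?thesis
  proof (cases "Z = {}")
    case True
    then have "D t \<noteq> 0" if "t \<in> {0<..\<tau>}" for t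
      using that by (auto simp: Z_def disjoint_iff)
    then have "D \<tau> \<le> D 0 - \<epsilon> * (\<tau> - 0)"
      using \<open>\<tau> \<ge> 0\<close> by (intro decay) auto
    then show ?thesis using D0 nonneg [of \<tau>] by simp
  next
    case False
    have "closed Z" unfolding Z_def
      by (intro continuous_closed_preimage abs_continuous_on_imp_continuous_on ac) auto
    moreover have bdd: "bdd_above Z" by (rule bdd_aboveI [of _ \<tau>]) (simp add: Z_def)
    ultimately have "Sup Z \<in> Z" using closed_contains_Sup False by blast
    then have s: "Sup Z \<in> {0..\<tau>}" "D (Sup Z) = 0" by (auto simp: Z_def)
    have "D t \<noteq> 0" if "t \<in> {Sup Z<..\<tau>}" for t
      using cSup_upper [OF _ bdd, of t] that s(1) by (auto simp: Z_def)
    then have "D \<tau> \<le> D (Sup Z) - \<epsilon> * (\<tau> - Sup Z)" by (intro decay s)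
    moreover have "0 \<le> \<epsilon> * (\<tau> - Sup Z)" using s(1) \<open>\<epsilon> > 0\<close> by simp
    ultimately show ?thesis using s(2) nonneg [of \<tau>] by linarith
  qed
qed

section \<open>Almost everywhere differentiability of Lipschitz functions\<close>

text \<open>By Vitali, disjoint intervals of slope at most \<open>p\<close> inside a slightly larger
  open set cover \<open>E\<close> up to a null set. Their images are covered by intervals at most
  \<open>p\<close> times as long, and the Lipschitz map sends the remaining null set to a null
  set.\<close>

lemma measure_mono_image_le:
  fixes g :: "real \<Rightarrow> real"
  assumes "mono g" and lip: "L-lipschitz_on UNIV g"
    and E: "E \<in> lmeasurable" and gE: "g ` E \<in> sets lebesgue" and "p \<ge> 0"
    and slope: "\<And>x d. x \<in> E \<Longrightarrow> d > 0 \<Longrightarrow>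
      \<exists>u v. u < x \<and> x < v \<and> v - u < d \<and> g v - g u \<le> p * (v - u)"
  shows "measure lebesgue (g ` E) \<le> p * measure lebesgue E"
proof (rule field_le_epsilon)
  fix e :: real assume "e > 0"
  define \<delta> where "\<delta> = e / (p + 1)"
  have "\<delta> > 0" using \<open>e > 0\<close> \<open>p \<ge> 0\<close> by (simp add: \<delta>_def)
  have p\<delta>: "p * \<delta> \<le> e" using \<open>e > 0\<close> \<open>p \<ge> 0\<close> by (simp add: \<delta>_def field_simps)
  have "E \<in> sets lebesgue" using E by blast
  then obtain U where U: "open U" "E \<subseteq> U" "U - E \<in> lmeasurable" "emeasure lebesgue (U - E) < ennreal \<delta>"
    using sets_lebesgue_outer_open \<open>\<delta> > 0\<close> by blast
  have UE: "U = (U - E) \<union> E" using U by blast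
  have Um: "U \<in> lmeasurable" by (subst UE) (intro fmeasurable.Un U E)
  have "measure lebesgue (U - E) < \<delta>"
    using U(3,4) \<open>\<delta> > 0\<close> by (metis emeasure_eq_measure2 ennreal_less_iff measure_nonneg)
  moreover have "measure lebesgue U \<le> measure lebesgue (U - E) + measure lebesgue E"
    by (subst UE, rule measure_Un_le) (use U E in auto)
  ultimately have mU: "measure lebesgue U \<le> measure lebesgue E + \<delta>" by linarith
  define K where "K = {(u, v). u < v \<and> {u..v} \<subseteq> U \<and> g v - g u \<le> p * (v - u)}"
  \<comment> \<open>Midpoint and half length of an interval: the covering theorem speaks of closed
    balls.\<close>
  define a r where "a = (\<lambda>(u::real, v::real). (u + v) / 2)" and "r = (\<lambda>(u::real, v::real). (v - u) / 2)"
  have ball: "cball (a i) (r i) = {fst i..snd i}" for i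
    by (cases i) (auto simp: a_def r_def cball_eq_atLeastAtMost field_simps)
  obtain C where C: "countable C" "C \<subseteq> K"
     "pairwise (\<lambda>i j. disjnt (cball (a i) (r i)) (cball (a j) (r j))) C"
     "negligible (E - (\<Union>i \<in> C. cball (a i) (r i)))"
  proof (rule Vitali_covering_theorem_cballs [of K r E a])
    show "0 < r i" if "i \<in> K" for i
      using that by (auto simp: K_def r_def)
    show "\<exists>i. i \<in> K \<and> x \<in> cball (a i) (r i) \<and> r i < d" if x: "x \<in> E" and d: "0 < d" for x d
    proof -
      obtain d' where d': "d' > 0" "ball x d' \<subseteq> U"
        using U x openE by blast
      then obtain u v where uv: "u < x" "x < v" "v - u < min d d'" "g v - g u \<le> p * (v - u)"
        using slope [OF x, of "min d d'"] d by auto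
      have "{u..v} \<subseteq> ball x d'" using uv by (auto simp: dist_real_def)
      then have "(u, v) \<in> K" using uv d' by (auto simp: K_def)
      moreover have "x \<in> cball (a (u, v)) (r (u, v))" using uv by (simp only: ball) simp
      moreover have "r (u, v) < d" using uv by (simp add: r_def)
      ultimately show ?thesis by blast
    qed
  qed
  let ?W = "\<lambda>C. \<Union>i\<in>C. {g (fst i)..g (snd i)}"
  \<comment> \<open>The bound is uniform over finite subfamilies, hence it passes to the countable
    union \<open>?W C\<close>.\<close>
  have bound: "measure lebesgue (?W I) \<le> p * measure lebesgue U" if I: "I \<subseteq> C" "finite I" for I
  proof -
    have K: "fst i \<le> snd i" "{fst i..snd i} \<subseteq> U" "g (snd i) - g (fst i) \<le> p * (snd i - fst i)"
      if "i \<in> I" for i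
    proof -
      have "i \<in> K" using that I C(2) by blast
      then show "fst i \<le> snd i" "{fst i..snd i} \<subseteq> U" "g (snd i) - g (fst i) \<le> p * (snd i - fst i)"
        by (auto simp: K_def case_prod_unfold)
    qed
    have "measure lebesgue (?W I) \<le> (\<Sum>i\<in>I. measure lebesgue {g (fst i)..g (snd i)})"
      by (rule measure_UNION_le) (use I in auto)
    also have "\<dots> \<le> (\<Sum>i\<in>I. p * measure lebesgue {fst i..snd i})"
    proof (rule sum_mono)
      fix i assume i: "i \<in> I"
      have "g (fst i) \<le> g (snd i)" using K(1) [OF i] \<open>mono g\<close> by (rule monoD [rotated])
      then show "measure lebesgue {g (fst i)..g (snd i)} \<le> p * measure lebesgue {fst i..snd i}"
        using K(1,3) [OF i] by simp
    qed
    also have "\<dots> = p * (\<Sum>i\<in>I. measure lebesgue {fst i..snd i})"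
      by (simp only: sum_distrib_left)
    also have "(\<Sum>i\<in>I. measure lebesgue {fst i..snd i}) = measure lebesgue (\<Union>i\<in>I. {fst i..snd i})"
    proof (rule measure_negligible_finite_Union_image [symmetric])
      show "pairwise (\<lambda>i j. negligible ({fst i..snd i} \<inter> {fst j..snd j})) I"
        using C(3) I(1) unfolding ball pairwise_def disjnt_def by (metis negligible_empty subsetD)
    qed (simp_all add: I)
    also have "p * \<dots> \<le> p * measure lebesgue U"
    proof (rule mult_left_mono [OF measure_mono_fmeasurable])
      show "(\<Union>i\<in>I. {fst i..snd i}) \<subseteq> U" using K(2) by blast
      show "(\<Union>i\<in>I. {fst i..snd i}) \<in> sets lebesgue"
        by (intro sets.finite_UN I) simp
    qed (fact Um \<open>p \<ge> 0\<close>)+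
    finally show ?thesis .
  qed
  have W: "?W C \<in> lmeasurable" "measure lebesgue (?W C) \<le> p * measure lebesgue U"
    using fmeasurable_UN_bound [OF C(1) _ bound] measure_UN_bound [OF C(1) _ bound] by simp_all
  define N where "N = g ` (E - (\<Union>i \<in> C. cball (a i) (r i)))"
  have "negligible N" unfolding N_def
  proof (rule negligible_locally_Lipschitz_image [OF order_refl C(4)])
    fix x
    have "norm (g y - g x) \<le> L * norm (y - x)" for y
      using lipschitz_onD [OF lip, of y x] by (simp add: dist_norm)
    then show "\<exists>T B. open T \<and> x \<in> T \<and>
        (\<forall>y\<in>(E - (\<Union>i\<in>C. cball (a i) (r i))) \<inter> T. norm (g y - g x) \<le> B * norm (y - x))"
      by (intro exI [of _ UNIV] exI [of _ L]) simp
  qed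
  then have N: "N \<in> lmeasurable" "measure lebesgue N = 0"
    by (auto simp: negligible_imp_measurable negligible_imp_measure0)
  have "g ` E \<subseteq> ?W C \<union> N"
  proof
    fix y assume "y \<in> g ` E"
    then obtain x where x: "x \<in> E" "y = g x" by blast
    show "y \<in> ?W C \<union> N"
    proof (cases "x \<in> (\<Union>i \<in> C. cball (a i) (r i))")
      case True
      then obtain i where "i \<in> C" "fst i \<le> x" "x \<le> snd i" unfolding ball by auto
      then have "g (fst i) \<le> y" "y \<le> g (snd i)" using \<open>mono g\<close> x by (auto dest: monoD)
      with \<open>i \<in> C\<close> show ?thesis by auto
    qed (use x in \<open>simp add: N_def\<close>)
  qed
  then have "measure lebesgue (g ` E) \<le> measure lebesgue (?W C \<union> N)"
    by (rule measure_mono_fmeasurable [OF _ gE]) (intro fmeasurable.Un W N)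
  also have "\<dots> \<le> measure lebesgue (?W C) + measure lebesgue N"
    by (rule measure_Un_le) (use W N in auto)
  also have "\<dots> \<le> p * (measure lebesgue E + \<delta>)"
    using W(2) N(2) mult_left_mono [OF mU \<open>p \<ge> 0\<close>] by linarith
  also have "\<dots> \<le> p * measure lebesgue E + e" using p\<delta> by (simp add: algebra_simps)
  finally show "measure lebesgue (g ` E) \<le> p * measure lebesgue E + e" .
qed

text \<open>A union of open intervals is open whatever its index set, so \<open>R\<close> may be
  arbitrary; the lengths \<open>1 / real (Suc n)\<close> reduce the condition for all
  \<open>d\<close> to a countable intersection.\<close>

lemma borel_straddled_points:
  fixes R :: "real \<Rightarrow> real \<Rightarrow> bool"
  shows "{x. \<forall>d>0. \<exists>u v. u < x \<and> x < v \<and> v - u < d \<and> R u v} \<in> sets borel"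
proof -
  define O' where "O' n = (\<Union>(u, v)\<in>{(u, v). v - u < 1 / real (Suc n) \<and> R u v}. {u<..<v})" for n
  have "{x. \<forall>d>0. \<exists>u v. u < x \<and> x < v \<and> v - u < d \<and> R u v} = (\<Inter>n. O' n)"
  proof (intro equalityI subsetI)
    fix x assume "x \<in> {x. \<forall>d>0. \<exists>u v. u < x \<and> x < v \<and> v - u < d \<and> R u v}"
    then have "\<exists>u v. u < x \<and> x < v \<and> v - u < 1 / real (Suc n) \<and> R u v" for n by simp
    then show "x \<in> (\<Inter>n. O' n)" by (fastforce simp: O'_def)
  next
    fix x assume x: "x \<in> (\<Inter>n. O' n)"
    have "\<exists>u v. u < x \<and> x < v \<and> v - u < d \<and> R u v" if d: "d > 0" for d
    proof -
      obtain n where n: "1 / real (Suc n) < d" using nat_approx_posE [OF d] by auto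
      have "x \<in> O' n" using x by blast
      then show ?thesis using n by (fastforce simp: O'_def)
    qed
    then show "x \<in> {x. \<forall>d>0. \<exists>u v. u < x \<and> x < v \<and> v - u < d \<and> R u v}" by blast
  qed
  moreover have "open (O' n)" for n by (auto simp: O'_def)
  ultimately show ?thesis by simp
qed

text \<open>To compare \<open>x\<close> with a point on one side, let the endpoint on the other side
  tend to \<open>x\<close>; continuity of \<open>g\<close> carries the estimate to the
  limit.\<close>

lemma has_real_derivative_straddleI:
  fixes g :: "real \<Rightarrow> real"
  assumes cont: "isCont g x"
    and str: "\<And>e. e > 0 \<Longrightarrow> \<exists>d>0. \<forall>u v. u < x \<longrightarrow> x < v \<longrightarrow> v - u < d \<longrightarrow>
      \<bar>g v - g u - l * (v - u)\<bar> \<le> e * (v - u)"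
  shows "(g has_real_derivative l) (at x)"
  unfolding has_field_derivative_def has_derivative_at_alt
proof (intro conjI allI impI)
  fix e :: real assume "e > 0"
  obtain d where "d > 0" and d: "\<And>u v. u < x \<Longrightarrow> x < v \<Longrightarrow> v - u < d \<Longrightarrow>
      \<bar>g v - g u - l * (v - u)\<bar> \<le> e * (v - u)"
    using str [OF \<open>e > 0\<close>] by blast
  show "\<exists>d>0. \<forall>y. norm (y - x) < d \<longrightarrow> norm (g y - g x - l * (y - x)) \<le> e * norm (y - x)"
  proof (intro exI conjI allI impI)
    fix y assume y: "norm (y - x) < d"
    consider "y = x" | "x < y" | "y < x" by linarith
    then show "norm (g y - g x - l * (y - x)) \<le> e * norm (y - x)"
    proof cases
      case 2
      have lim: "(g \<longlongrightarrow> g x) (at_left x)"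
        using cont by (simp add: isCont_def filterlim_at_split)
      have "\<forall>\<^sub>F u in at_left x. y - d < u"
        using y 2 by (intro order_tendstoD(1) [OF tendsto_ident_at]) auto
      then have "\<forall>\<^sub>F u in at_left x. \<bar>g y - g u - l * (y - u)\<bar> \<le> e * (y - u)"
        using eventually_at_left_real [of "x - 1" x, simplified]
        by eventually_elim (use d 2 in auto)
      then have "\<bar>g y - g x - l * (y - x)\<bar> \<le> e * (y - x)"
        by (rule tendsto_le [rotated 3]) (auto intro!: tendsto_intros lim)
      then show ?thesis using 2 by simp
    next
      case 3
      have lim: "(g \<longlongrightarrow> g x) (at_right x)"
        using cont by (simp add: isCont_def filterlim_at_split)
      have "\<forall>\<^sub>F v in at_right x. v < y + d"
        using y 3 by (intro order_tendstoD(2) [OF tendsto_ident_at]) auto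
      then have "\<forall>\<^sub>F v in at_right x. \<bar>g v - g y - l * (v - y)\<bar> \<le> e * (v - y)"
        using eventually_at_right_real [of x "x + 1", simplified]
        by eventually_elim (use d 3 in auto)
      then have "\<bar>g x - g y - l * (x - y)\<bar> \<le> e * (x - y)"
        by (rule tendsto_le [rotated 3]) (auto intro!: tendsto_intros lim)
      then show ?thesis using 3 by (simp add: abs_if algebra_simps split: if_splits)
    qed simp
  qed (fact \<open>d > 0\<close>)
qed (rule bounded_linear_mult_right)

text \<open>Applying the measure bound to \<open>g\<close> and to its inverse gives \<open>q |E| \<le> |g E| \<le> p |E|\<close>.
  The intervals strictly straddle the point, which makes the set \<open>E\<close> a countable intersection of open sets.\<close>

lemma negligible_crossing_slopes:
  fixes g h :: "real \<Rightarrow> real"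
  assumes g: "mono g" "L-lipschitz_on UNIV g" and h: "mono h" "L'-lipschitz_on UNIV h"
    and hg: "\<And>x. h (g x) = x" and gh: "\<And>y. g (h y) = y" and pq: "0 \<le> p" "p < q"
  shows "negligible ({x. \<forall>d>0. \<exists>u v. u < x \<and> x < v \<and> v - u < d \<and> g v - g u \<le> p * (v - u)} \<inter>
                     {x. \<forall>d>0. \<exists>u v. u < x \<and> x < v \<and> v - u < d \<and> q * (v - u) \<le> g v - g u})"
    (is "negligible (?A \<inter> ?B)")
proof -
  \<comment> \<open>Truncation makes the measure of \<open>E\<close> finite, so that
    \<open>q |E| \<le> p |E|\<close> with \<open>p < q\<close> forces it to vanish.\<close>
  have "?A \<inter> ?B \<inter> {- real n..real n} \<in> null_sets lebesgue" for n
  proof -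
    define E where "E = ?A \<inter> ?B \<inter> {- real n..real n}"
    have Eb: "E \<in> sets borel"
      unfolding E_def by (intro sets.Int borel_straddled_points) simp
    have E: "E \<in> lmeasurable"
      using Eb by (intro bounded_set_imp_lmeasurable) (auto simp: E_def bounded_Int)
    \<comment> \<open>As a preimage under the continuous inverse, the image of a Borel set is
      Borel.\<close>
    have gE: "g ` E = h -` E"
    proof (intro equalityI subsetI)
      show "y \<in> g ` E" if "y \<in> h -` E" for y
        using that gh [of y] by (metis image_eqI vimageE)
    qed (auto simp: hg)
    have "h \<in> borel_measurable borel"
      using lipschitz_on_continuous_on [OF h(2)] by (rule borel_measurable_continuous_onI)
    then have "g ` E \<in> sets borel" using measurable_sets_borel [OF _ Eb] gE by metis
    moreover have "bounded (g ` E)"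
      by (rule bounded_subset [of "{g (- real n)..g (real n)}"])
        (use g(1) in \<open>auto simp: E_def dest: monoD\<close>)
    ultimately have gEm: "g ` E \<in> lmeasurable"
      by (intro bounded_set_imp_lmeasurable) auto
    have le1: "measure lebesgue (g ` E) \<le> p * measure lebesgue E"
      by (rule measure_mono_image_le [OF g E _ pq(1)]) (use gEm in \<open>auto simp: E_def\<close>)
    have hgE: "h ` g ` E = E" using hg by (simp add: image_image)
    have "measure lebesgue (h ` g ` E) \<le> (1 / q) * measure lebesgue (g ` E)"
    proof (rule measure_mono_image_le [OF h gEm])
      show "h ` g ` E \<in> sets lebesgue" using hgE E by auto
      show "0 \<le> 1 / q" using pq by simp
      fix y d :: real assume y: "y \<in> g ` E" and "d > 0"
      then obtain x where x: "x \<in> ?B" "y = g x" by (auto simp: E_def)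
      have "L \<ge> 0" using lipschitz_on_nonneg [OF g(2)] .
      \<comment> \<open>Since \<open>g\<close> stretches lengths by at most \<open>L\<close>, this
        length keeps the image interval shorter than \<open>d\<close>.\<close>
      then have "d / (L + 1) > 0" using \<open>d > 0\<close> by simp
      then obtain u v where uv: "u < x" "x < v" "v - u < d / (L + 1)" "q * (v - u) \<le> g v - g u"
        using x(1) by blast
      have "g u \<le> g x" "g x \<le> g v" using uv by (simp_all add: monoD [OF g(1)])
      moreover have "g u \<noteq> g x" "g x \<noteq> g v"
        using uv hg [of u] hg [of x] hg [of v] by auto
      ultimately have "g u < y" "y < g v" using x(2) by auto
      moreover have "g v - g u < d"
      proof -
        have "g v - g u \<le> L * (v - u)"
          using lipschitz_onD [OF g(2), of v u] uv by (simp add: dist_real_def)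
        also have "\<dots> \<le> (L + 1) * (v - u)" using uv by (simp add: algebra_simps)
        also have "\<dots> < d" using uv(3) \<open>L \<ge> 0\<close> by (simp add: field_simps)
        finally show ?thesis .
      qed
      moreover have "h (g v) - h (g u) \<le> 1 / q * (g v - g u)"
        using uv(4) pq by (simp add: hg field_simps)
      ultimately show "\<exists>u v. u < y \<and> y < v \<and> v - u < d \<and> h v - h u \<le> 1 / q * (v - u)" by blast
    qed
    then have "q * measure lebesgue E \<le> measure lebesgue (g ` E)"
      using pq by (simp add: hgE field_simps)
    with le1 have "(q - p) * measure lebesgue E \<le> 0" by (simp add: algebra_simps)
    then have "measure lebesgue E = 0"
      using pq by (simp add: mult_le_0_iff measure_le_0_iff)
    then have "negligible E" using E by (simp add: negligible_iff_measure)
    then show ?thesis by (simp add: E_def negligible_iff_null_sets)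
  qed
  then have "(\<Union>n. ?A \<inter> ?B \<inter> {- real n..real n}) \<in> null_sets lebesgue"
    by (rule null_sets_UN)
  moreover have "?A \<inter> ?B \<subseteq> (\<Union>n. ?A \<inter> ?B \<inter> {- real n..real n})"
  proof
    fix x assume x: "x \<in> ?A \<inter> ?B"
    obtain n where "\<bar>x\<bar> \<le> real n" using real_arch_simple by blast
    then have "x \<in> {- real n..real n}" by auto
    with x show "x \<in> (\<Union>n. ?A \<inter> ?B \<inter> {- real n..real n})" by blast
  qed
  ultimately show ?thesis
    by (meson negligible_iff_null_sets negligible_subset)
qed

text \<open>Where \<open>g\<close> is not differentiable, two rationals \<open>0 \<le> p < q\<close>
  separate the smallest and the largest limiting slopes over straddling intervals. Each such pair
  contributes a null set, and there are countably many pairs.\<close>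

lemma negligible_non_differentiable_bilipschitz:
  fixes g h :: "real \<Rightarrow> real"
  assumes g: "mono g" "L-lipschitz_on UNIV g" and h: "mono h" "L'-lipschitz_on UNIV h"
    and hg: "\<And>x. h (g x) = x" and gh: "\<And>y. g (h y) = y"
  shows "negligible {x. \<nexists>l. (g has_real_derivative l) (at x)}"
proof -
  define A where "A p = {x. \<forall>d>0. \<exists>u v. u < x \<and> x < v \<and> v - u < d \<and> g v - g u \<le> p * (v - u)}" for p
  define B where "B q = {x. \<forall>d>0. \<exists>u v. u < x \<and> x < v \<and> v - u < d \<and> q * (v - u) \<le> g v - g u}" for q
  define I where "I = {(p, q). p \<in> \<rat> \<and> q \<in> \<rat> \<and> 0 \<le> p \<and> p < (q::real)}"
  have "countable I"
    by (rule countable_subset [of _ "\<rat> \<times> \<rat>"]) (auto simp: I_def countable_rat)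
  then have "(\<Union>i\<in>I. A (fst i) \<inter> B (snd i)) \<in> null_sets lebesgue"
  proof (rule null_sets_UN')
    show "A (fst i) \<inter> B (snd i) \<in> null_sets lebesgue" if "i \<in> I" for i
      using negligible_crossing_slopes [OF g h hg gh, of "fst i" "snd i"] that
      by (auto simp: I_def A_def B_def negligible_iff_null_sets)
  qed
  moreover have "{x. \<nexists>l. (g has_real_derivative l) (at x)} \<subseteq> (\<Union>i\<in>I. A (fst i) \<inter> B (snd i))"
  proof (rule subsetI, rule ccontr)
    fix x assume nd: "x \<in> {x. \<nexists>l. (g has_real_derivative l) (at x)}"
      and notin: "x \<notin> (\<Union>i\<in>I. A (fst i) \<inter> B (snd i))"
    \<comment> \<open>The slopes reached or exceeded on arbitrarily short intervals around
      \<open>x\<close>. Monotonicity gives \<open>0 \<in> Q\<close> and the Lipschitz bound limits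
      \<open>Q\<close> by \<open>L\<close>, so the supremum is the upper straddled derivative, the
      candidate for the derivative.\<close>
    define Q where "Q = {q. x \<in> B q}"
    have "0 \<in> Q"
    proof -
      have "\<exists>u v. u < x \<and> x < v \<and> v - u < d \<and> 0 * (v - u) \<le> g v - g u" if "d > 0" for d
        using that monoD [OF g(1), of "x - d/3" "x + d/3"]
        by (intro exI [of _ "x - d/3"] exI [of _ "x + d/3"]) simp
      then show ?thesis by (simp add: Q_def B_def)
    qed
    have bdd: "q \<le> L" if q: "q \<in> Q" for q
    proof -
      obtain u v where uv: "u < x" "x < v" "q * (v - u) \<le> g v - g u"
        using q unfolding Q_def B_def mem_Collect_eq by (metis zero_less_one)
      note uv(3)
      also have "g v - g u \<le> L * (v - u)"
        using lipschitz_onD [OF g(2), of v u] uv by (simp add: dist_real_def)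
      finally show ?thesis using uv by simp
    qed
    then have "bdd_above Q" by (rule bdd_aboveI)
    define l where "l = Sup Q"
    have "(g has_real_derivative l) (at x)"
    proof (rule has_real_derivative_straddleI)
      show "isCont g x"
        using lipschitz_on_continuous_on [OF g(2)] by (simp add: continuous_on_eq_continuous_at)
      fix e :: real assume "e > 0"
      have "l + e \<notin> Q"
        using cSup_upper [OF _ \<open>bdd_above Q\<close>, of "l + e"] \<open>e > 0\<close> by (auto simp: l_def)
      then obtain d1 where d1: "d1 > 0" "\<And>u v. u < x \<Longrightarrow> x < v \<Longrightarrow> v - u < d1 \<Longrightarrow>
          g v - g u < (l + e) * (v - u)"
        by (simp add: Q_def B_def not_le) (meson not_le)
      obtain d2 where d2: "d2 > 0" "\<And>u v. u < x \<Longrightarrow> x < v \<Longrightarrow> v - u < d2 \<Longrightarrow>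
          (l - e) * (v - u) \<le> g v - g u"
      \<comment> \<open>For a negative lower slope monotonicity suffices; otherwise the rationals
        chosen between \<open>l - e\<close> and \<open>l\<close> are nonnegative, as membership in
        \<open>I\<close> demands.\<close>
      proof (cases "l - e < 0")
        case True
        have "(l - e) * (v - u) \<le> g v - g u" if "u < x" "x < v" for u v
        proof -
          have "(l - e) * (v - u) \<le> 0" using True that by (simp add: mult_nonpos_nonneg)
          also have "0 \<le> g v - g u" using that g(1) by (simp add: monoD)
          finally show ?thesis .
        qed
        then show ?thesis using that [of 1] by simp
      next
        case False
        obtain q where q: "q \<in> \<rat>" "l - e < q" "q < l" using Rats_dense_in_real [of "l - e" l] \<open>e > 0\<close> by auto
        obtain p where p: "p \<in> \<rat>" "l - e < p" "p < q" using Rats_dense_in_real [OF q(2)] by blast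
        obtain q' where q': "q' \<in> Q" "q < q'"
          using less_cSupE [of q Q] \<open>0 \<in> Q\<close> q(3) by (metis empty_iff l_def)
        \<comment> \<open>An element of \<open>Q\<close> above \<open>q\<close> shows that slopes of
          at least \<open>q\<close> recur at \<open>x\<close>; as \<open>x\<close> avoids all
          crossing sets, slopes of at most \<open>p\<close> cannot recur as well.\<close>
        have "x \<in> B q"
        proof -
          have "q * (v - u) \<le> q' * (v - u)" if "u < x" "x < v" for u v
            using q'(2) that by (intro mult_right_mono) auto
          then show ?thesis using q'(1) unfolding Q_def B_def mem_Collect_eq by (meson order_trans)
        qed
        moreover have "(p, q) \<in> I" using p q False by (auto simp: I_def)
        ultimately have "x \<notin> A p" using notin by (metis IntI UN_I fst_conv snd_conv)
        then obtain d where d: "d > 0" "\<And>u v. u < x \<Longrightarrow> x < v \<Longrightarrow> v - u < d \<Longrightarrow>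
          p * (v - u) < g v - g u"
          by (simp add: A_def) (meson not_le)
        have "(l - e) * (v - u) \<le> g v - g u" if "u < x" "x < v" "v - u < d" for u v
        proof -
          have "(l - e) * (v - u) \<le> p * (v - u)" using p(2) that by (intro mult_right_mono) auto
          also have "\<dots> \<le> g v - g u" using d(2) [OF that] by simp
          finally show ?thesis .
        qed
        then show ?thesis using that [of d] d(1) by blast
      qed
      show "\<exists>d>0. \<forall>u v. u < x \<longrightarrow> x < v \<longrightarrow> v - u < d \<longrightarrow> \<bar>g v - g u - l * (v - u)\<bar> \<le> e * (v - u)"
      proof (intro exI [of _ "min d1 d2"] conjI allI impI)
        fix u v assume "u < x" "x < v" "v - u < min d1 d2"
        then have "g v - g u < (l + e) * (v - u)" "(l - e) * (v - u) \<le> g v - g u"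
          using d1 d2 by auto
        then show "\<bar>g v - g u - l * (v - u)\<bar> \<le> e * (v - u)" by (simp add: algebra_simps abs_le_iff)
      qed (use d1 d2 in auto)
    qed
    then show False using nd by blast
  qed
  ultimately show ?thesis
    by (meson negligible_iff_null_sets negligible_subset)
qed

text \<open>Adding \<open>(L + 1) * t\<close> preserves differentiability and yields an increasing
  function that does not shrink distances. It is a bijection of the line whose inverse is Lipschitz
  with constant 1.\<close>

lemma negligible_non_differentiable_lipschitz_real:
  fixes f :: "real \<Rightarrow> real"
  assumes lip: "L-lipschitz_on UNIV f"
  shows "negligible {x. \<nexists>l. (f has_real_derivative l) (at x)}"
proof -
  define g where "g t = f t + (L + 1) * t" for t
  have "L \<ge> 0" using lipschitz_on_nonneg [OF lip] .
  have f: "\<bar>f v - f u\<bar> \<le> L * (v - u)" if "u \<le> v" for u v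
    using lipschitz_onD [OF lip, of v u] that by (simp add: dist_real_def)
  have expand: "v - u \<le> g v - g u" if "u \<le> v" for u v
    using f [OF that] by (simp add: g_def algebra_simps abs_le_iff)
  have "strict_mono g"
    using expand by (intro strict_monoI) (smt (verit))
  then have "mono g" "inj g" by (auto simp: strict_mono_mono strict_mono_on_imp_inj_on)
  have lipg: "(L + \<bar>L + 1\<bar> * 1)-lipschitz_on UNIV g"
    unfolding g_def by (intro lipschitz_intros lip)
  have "surj g"
  proof -
    have "\<exists>x. g x = y" for y
    proof -
      \<comment> \<open>By expansion \<open>g\<close> rises by at least \<open>M\<close> on
        \<open>{0..M}\<close> and on \<open>{-M..0}\<close>, so its values at the ends enclose
        \<open>y\<close>.\<close>
      define M where "M = \<bar>y - g 0\<bar>"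
      have "continuous_on {-M..M} g"
        using lipschitz_on_continuous_on [OF lipg] by (rule continuous_on_subset) simp
      moreover have "g (- M) \<le> y" "y \<le> g M" "- M \<le> M"
        using expand [of 0 M] expand [of "- M" 0] by (auto simp: M_def)
      ultimately show ?thesis using IVT' [of g "- M" y M] by blast
    qed
    then show ?thesis by (metis surjI)
  qed
  define h where "h = inv g"
  have hg: "h (g x) = x" and gh: "g (h y) = y" for x y
    using \<open>inj g\<close> \<open>surj g\<close> by (simp_all add: h_def surj_f_inv_f)
  have "mono h"
    using \<open>strict_mono g\<close> gh by (intro monoI) (metis strict_mono_less_eq)
  moreover have "1-lipschitz_on UNIV h"
  proof (rule lipschitz_onI)
    fix x y :: real
    consider "h x \<le> h y" | "h y \<le> h x" by linarith
    then show "dist (h x) (h y) \<le> 1 * dist x y"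
      using expand [of "h x" "h y"] expand [of "h y" "h x"] by cases (auto simp: gh dist_real_def)
  qed simp
  ultimately have "negligible {x. \<nexists>l. (g has_real_derivative l) (at x)}"
    by (intro negligible_non_differentiable_bilipschitz [OF \<open>mono g\<close> lipg _ _ hg gh])
  moreover have "\<exists>l. (f has_real_derivative l) (at x)" if "(g has_real_derivative l) (at x)" for l x
  proof -
    have "((\<lambda>t. g t - (L + 1) * t) has_real_derivative l - (L + 1)) (at x)"
      using that by (auto intro!: derivative_eq_intros)
    then show ?thesis by (auto simp: g_def)
  qed
  then have "{x. \<nexists>l. (f has_real_derivative l) (at x)} \<subseteq> {x. \<nexists>l. (g has_real_derivative l) (at x)}"
    by blast
  ultimately show ?thesis by (rule negligible_subset)
qed

lemma negligible_non_differentiable_lipschitz: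
  fixes f :: "real \<Rightarrow> 'a::euclidean_space"
  assumes lip: "L-lipschitz_on UNIV f"
  shows "negligible {x. \<nexists>l. (f has_vector_derivative l) (at x)}"
proof -
  have *: "negligible {x. \<nexists>l. ((\<lambda>t. f t \<bullet> i) has_real_derivative l) (at x)}" if "i \<in> Basis" for i
  proof (rule negligible_non_differentiable_lipschitz_real)
    show "L-lipschitz_on UNIV (\<lambda>t. f t \<bullet> i)"
    proof (rule lipschitz_onI)
      fix x y
      have "dist (f x \<bullet> i) (f y \<bullet> i) \<le> dist (f x) (f y)"
        using Basis_le_norm [OF that, of "f x - f y"] by (simp add: dist_norm inner_diff_left)
      also have "\<dots> \<le> L * dist x y" using lipschitz_onD [OF lip] by simp
      finally show "dist (f x \<bullet> i) (f y \<bullet> i) \<le> L * dist x y" .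
    qed (rule lipschitz_on_nonneg [OF lip])
  qed
  let ?N = "\<lambda>i. {x. \<nexists>l. ((\<lambda>t. f t \<bullet> i) has_real_derivative l) (at x)}"
  have "negligible (\<Union>(?N ` Basis))"
  proof (rule negligible_Union)
    show "negligible T" if "T \<in> ?N ` Basis" for T
      using that by (elim imageE) (simp only: *)
  qed simp
  moreover have "{x. \<nexists>l. (f has_vector_derivative l) (at x)} \<subseteq> \<Union>(?N ` Basis)"
  proof (rule subsetI, rule ccontr)
    fix x assume nd: "x \<in> {x. \<nexists>l. (f has_vector_derivative l) (at x)}" and "x \<notin> \<Union>(?N ` Basis)"
    then have "\<forall>i\<in>Basis. \<exists>l. ((\<lambda>t. f t \<bullet> i) has_real_derivative l) (at x)" by simp
    then obtain l where l: "\<And>i. i \<in> Basis \<Longrightarrow> ((\<lambda>t. f t \<bullet> i) has_real_derivative l i) (at x)"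
      by metis
    have "(f has_vector_derivative (\<Sum>i\<in>Basis. l i *\<^sub>R i)) (at x)"
      unfolding has_vector_derivative_def
    proof (subst has_derivative_componentwise_within, intro ballI)
      fix i :: 'a assume i: "i \<in> Basis"
      have "(\<lambda>x. x *\<^sub>R (\<Sum>i\<in>Basis. l i *\<^sub>R i) \<bullet> i) = (*) (l i)"
        using i by (auto simp: fun_eq_iff)
      then show "((\<lambda>x. f x \<bullet> i) has_derivative (\<lambda>x. x *\<^sub>R (\<Sum>i\<in>Basis. l i *\<^sub>R i) \<bullet> i)) (at x)"
        using l [OF i] by (simp add: has_field_derivative_def)
    qed
    with nd show False by blast
  qed
  ultimately show ?thesis by (rule negligible_subset)
qed

section \<open>The distance to a convex set along a curve\<close>

lemma has_real_derivative_squeeze: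
  fixes f g h :: "real \<Rightarrow> real"
  assumes f: "(f has_real_derivative k) (at t)" and h: "(h has_real_derivative k) (at t)"
    and le: "\<And>s. f s \<le> g s" "\<And>s. g s \<le> h s" and eq: "f t = h t"
  shows "(g has_real_derivative k) (at t)"
  unfolding has_field_derivative_def has_derivative_at_alt
proof (intro conjI allI impI)
  fix e :: real assume "e > 0"
  obtain d1 where d1: "d1 > 0" "\<And>y. norm (y - t) < d1 \<Longrightarrow> norm (f y - f t - k * (y - t)) \<le> e * norm (y - t)"
    using f \<open>e > 0\<close> unfolding has_field_derivative_def has_derivative_at_alt by blast
  obtain d2 where d2: "d2 > 0" "\<And>y. norm (y - t) < d2 \<Longrightarrow> norm (h y - h t - k * (y - t)) \<le> e * norm (y - t)"
    using h \<open>e > 0\<close> unfolding has_field_derivative_def has_derivative_at_alt by blast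
  show "\<exists>d>0. \<forall>y. norm (y - t) < d \<longrightarrow> norm (g y - g t - k * (y - t)) \<le> e * norm (y - t)"
  proof (intro exI [of _ "min d1 d2"] conjI allI impI)
    fix y assume "norm (y - t) < min d1 d2"
    then have "norm (f y - f t - k * (y - t)) \<le> e * norm (y - t)"
      "norm (h y - h t - k * (y - t)) \<le> e * norm (y - t)" using d1(2) d2(2) by auto
    moreover have "g t = f t" using le [of t] eq by simp
    ultimately show "norm (g y - g t - k * (y - t)) \<le> e * norm (y - t)"
      using le [of y] eq unfolding real_norm_def by linarith
  qed (use d1(1) d2(1) in auto)
qed (rule bounded_linear_mult_right)

lemma infdist_eq_dist_closest_point:
  "\<lbrakk>closed S; S \<noteq> {}\<rbrakk> \<Longrightarrow> infdist a S = dist a (closest_point S a)"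
  by (simp add: infdist_eq_setdist setdist_closest_point)

text \<open>The distance is squeezed between the distance to the supporting hyperplane at the closest point
  and the distance to the closest point itself.\<close>

lemma infdist_has_real_derivative:
  fixes S :: "'a::euclidean_space set"
  assumes S: "closed S" "convex S" "S \<noteq> {}" and x: "(x has_vector_derivative x') (at t)"
    and pos: "infdist (x t) S > 0"
  shows "((\<lambda>s. infdist (x s) S) has_real_derivative
    (x' \<bullet> (x t - closest_point S (x t))) / infdist (x t) S) (at t)"
proof -
  define z where "z = closest_point S (x t)"
  define D where "D = infdist (x t) S"
  have z: "z \<in> S" "D = norm (x t - z)"
    using S by (simp_all add: z_def D_def closest_point_in_set infdist_eq_dist_closest_point dist_norm)
  have "D > 0" using pos by (simp add: D_def)
  show ?thesis unfolding z_def [symmetric] D_def [symmetric]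
  proof (rule has_real_derivative_squeeze)
    have xz: "((\<lambda>s. x s - z) has_vector_derivative x') (at t)"
      using has_vector_derivative_diff [OF x has_vector_derivative_const [of z]] by simp
    have "bounded_linear (\<lambda>w. w \<bullet> (x t - z) / D)"
      using bounded_linear_inner_left [of "(1 / D) *\<^sub>R (x t - z)"] by simp
    from bounded_linear.has_vector_derivative [OF this xz]
    show "((\<lambda>s. (x s - z) \<bullet> (x t - z) / D) has_real_derivative x' \<bullet> (x t - z) / D) (at t)"
      by (simp add: has_real_derivative_iff_has_vector_derivative)
    \<comment> \<open>The norm is differentiable here because \<open>D > 0\<close> keeps its
      argument away from the origin.\<close>
    have "(norm has_derivative (\<lambda>h. h \<bullet> sgn (x t - z))) (at (x t - z))"
      using has_derivative_norm [of "x t - z"] \<open>D > 0\<close> z(2) by simp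
    from has_derivative_compose [OF xz [unfolded has_vector_derivative_def] this]
    have "((\<lambda>s. norm (x s - z)) has_derivative (\<lambda>h. h *\<^sub>R x' \<bullet> sgn (x t - z))) (at t)" .
    moreover have "(\<lambda>h. h *\<^sub>R x' \<bullet> sgn (x t - z)) = (*) (x' \<bullet> (x t - z) / D)"
      by (simp add: fun_eq_iff sgn_div_norm z(2) divide_inverse mult_ac del: inner_diff_right scaleR_right_diff_distrib)
    ultimately show "((\<lambda>s. norm (x s - z)) has_real_derivative x' \<bullet> (x t - z) / D) (at t)"
      by (simp add: has_field_derivative_def)
    show "(x t - z) \<bullet> (x t - z) / D = norm (x t - z)"
      using \<open>D > 0\<close> by (simp add: z(2) dot_square_norm power2_eq_square)
    fix s
    show "infdist (x s) S \<le> norm (x s - z)"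
      using infdist_le [OF z(1), of "x s"] by (simp add: dist_norm)
    show "(x s - z) \<bullet> (x t - z) / D \<le> infdist (x s) S"
    proof -
      \<comment> \<open>\<open>S\<close> lies beyond the hyperplane through \<open>z\<close>, so
        replacing \<open>z\<close> by any \<open>w \<in> S\<close> can only increase the inner
        product; Cauchy-Schwarz then gives the distance.\<close>
      define w where "w = closest_point S (x s)"
      have "w \<in> S" using S by (simp add: w_def closest_point_in_set)
      then have "(x t - z) \<bullet> (w - z) \<le> 0"
        unfolding z_def by (intro closest_point_dot S)
      then have "(x s - z) \<bullet> (x t - z) \<le> (x s - w) \<bullet> (x t - z)"
        by (simp add: algebra_simps inner_commute)
      also have "\<dots> \<le> norm (x s - w) * D"
        unfolding z(2) by (rule norm_cauchy_schwarz)
      finally have "(x s - z) \<bullet> (x t - z) / D \<le> norm (x s - w)"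
        using \<open>D > 0\<close> by (simp add: divide_le_eq)
      also have "\<dots> = infdist (x s) S"
        using S by (simp add: w_def infdist_eq_dist_closest_point dist_norm)
      finally show ?thesis .
    qed
  qed
qed

section \<open>Finite-time attraction\<close>

theorem theorem1:
  fixes V :: "(real^'m) set" and d :: nat and A :: "real^'m^'m"
    and c y :: "real \<Rightarrow> real^'m" and F C :: "(real^'m) set" and \<epsilon> \<tau> M :: real
  assumes "subspace V" and "dim V = d"
    and "\<forall>i j. i \<noteq> j \<longrightarrow> A $ i $ j = 0" and "\<forall>i. A $ i $ i > 0"
    and "\<forall>t\<ge>0. c t \<in> V" and "\<exists>L. L-lipschitz_on {0..} c"
    and "F \<noteq> {}" and "closed F" and "convex F"
    and "C \<noteq> {}" and "closed C" and "convex C"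
    and "F \<subseteq> C" and "C \<subseteq> V"
    and "\<epsilon> > 0"
    and "AE t\<in>{0..\<tau>} in lebesgue. \<forall>z\<in>F.
           (+) (- vector_derivative c (at t within {0..})) ` (ball_wrt V A \<epsilon> \<inter> normal_cone V A F z)
             \<subseteq> normal_cone V A C z"
    and "M \<in> {norm_wrt A (v1 - v2) | v1 v2. v1 \<in> C \<and> v2 \<in> F}"
    and "\<forall>r \<in> {norm_wrt A (v1 - v2) | v1 v2. v1 \<in> C \<and> v2 \<in> F}. r \<le> M"
    and "\<tau> \<ge> 1 / \<epsilon> * M"
    and "sweeping_solution V A (\<lambda>t. (+) (c t) ` C) y"
    and "y 0 \<in> (+) (c 0) ` C"
  shows "y \<tau> \<in> (+) (c \<tau>) ` F"
proof -
  note V = assms(1) and diag = assms(3) and pos = assms(4) and lip = assms(6)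
    and F = assms(7-9) and FC = assms(13) and CV = assms(14) and eps = assms(15) and cone = assms(16)
    and M = assms(17,18) and \<tau> = assms(19) and sol = assms(20)
  \<comment> \<open>\<open>B\<close> is the square root of \<open>A\<close>: it turns the scalar product \<open>(x, y)\<^sub>A\<close> into the Euclidean one.\<close>
  define B :: "real^'m \<Rightarrow> real^'m" where "B x = (\<chi> i. sqrt (A $ i $ i) * x $ i)" for x
  have inner_B: "B x \<bullet> B w = x \<bullet> (A *v w)" for x w
  proof -
    have "(A *v w) $ i = A $ i $ i * w $ i" for i
    proof -
      have "(\<Sum>j\<in>UNIV. A $ i $ j * w $ j) = (\<Sum>j\<in>{i}. A $ i $ j * w $ j)"
        by (rule sum.mono_neutral_right) (use diag in auto)
      then show ?thesis by (simp add: matrix_vector_mult_def)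
    qed
    moreover have "sqrt (A $ i $ i) * x $ i * (sqrt (A $ i $ i) * w $ i) = x $ i * (A $ i $ i * w $ i)" for i
    proof -
      have "sqrt (A $ i $ i) * sqrt (A $ i $ i) = A $ i $ i" using pos by (simp add: less_imp_le)
      then show ?thesis by (metis mult.assoc mult.commute)
    qed
    ultimately show ?thesis
      by (simp only: inner_vec_def B_def vec_lambda_beta inner_real_def)
  qed
  have norm_B: "norm_wrt A x = norm (B x)" for x
    by (simp add: norm_wrt_def norm_eq_sqrt_inner inner_B)
  have linB: "linear B"
    by (rule linearI) (simp_all add: B_def vec_eq_iff algebra_simps)
  then have blB: "bounded_linear B" by (simp add: linear_conv_bounded_linear)
  have B_diff: "B (x - w) = B x - B w" for x w using linB by (rule linear_diff)
  have B_scale: "B (r *\<^sub>R x) = r *\<^sub>R B x" for r x using linB by (rule linear_cmul)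
  have B_add: "B (x + w) = B x + B w" for x w using linB by (rule linear_add)
  have B_minus: "B (- x) = - B x" for x using linB by (rule linear_neg)
  have "inj B"
  proof (rule injI)
    fix x w assume "B x = B w"
    then have "sqrt (A $ i $ i) * x $ i = sqrt (A $ i $ i) * w $ i" for i
      by (simp add: B_def vec_eq_iff)
    moreover have "sqrt (A $ i $ i) \<noteq> 0" for i using pos by (metis less_irrefl real_sqrt_eq_zero_cancel_iff)
    ultimately show "x = w" by (metis mult_cancel_left vec_eq_iff)
  qed

  \<comment> \<open>The distance to \<open>F\<close> in Euclidean coordinates\<close>
  define G where "G = B ` F"
  have G: "closed G" "convex G" "G \<noteq> {}"
    using F linB \<open>inj B\<close> by (auto simp: G_def closed_injective_linear_image convex_linear_image)
  define x where "x t = B (y t - c t)" for t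
  define D where "D t = infdist (x t) G" for t
  obtain v1 v2 where "M = norm_wrt A (v1 - v2)" using M(1) by blast
  then have "M \<ge> 0" by (simp add: norm_B)
  then have "0 \<le> 1 / \<epsilon> * M" using eps by simp
  then have "\<tau> \<ge> 0" using \<tau> by (rule order_trans)
  have "M \<le> \<epsilon> * \<tau>" using \<tau> eps by (simp add: field_simps)
  obtain L where L: "L-lipschitz_on {0..} c" using lip by blast
  have y_in: "y t - c t \<in> C" if "t \<ge> 0" for t
  proof -
    have "y t \<in> (+) (c t) ` C" using sol that by (simp add: sweeping_solution_def)
    then show ?thesis by auto
  qed
  have "D \<tau> = 0"
  proof -

    \<comment> \<open>Absolute continuity of the distance\<close>
    have acy: "abs_continuous_on {0..\<tau>} y"
      using sol \<open>\<tau> \<ge> 0\<close> by (simp add: sweeping_solution_def locally_abs_continuous_def)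
    obtain K where K: "K > 0" "\<And>w. norm (B w) \<le> norm w * K"
      using bounded_linear.pos_bounded [OF blB] by blast
    have "L \<ge> 0" using lipschitz_on_nonneg [OF L] .
    \<comment> \<open>The distance to a set is 1-Lipschitz and \<open>B\<close> is bounded, so
      increments of \<open>D\<close> are controlled by those of \<open>y\<close> and, through the
      Lipschitz constant of \<open>c\<close>, by the elapsed time.\<close>
    have acD: "abs_continuous_on {0..\<tau>} D"
    proof (rule abs_continuous_on_dominated [OF acy])
      show "K \<ge> 0" "L * K \<ge> 0" using K(1) \<open>L \<ge> 0\<close> by simp_all
      fix a b assume ab: "a \<in> {0..\<tau>}" "b \<in> {0..\<tau>}" "a \<le> b"
      have "norm (D b - D a) \<le> norm (x b - x a)"
        using infdist_triangle_abs [of "x b" G "x a"] by (simp add: D_def dist_norm)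
      also have "\<dots> = norm (B ((y b - y a) - (c b - c a)))"
        unfolding x_def B_diff by (simp add: algebra_simps)
      also have "\<dots> \<le> norm ((y b - y a) - (c b - c a)) * K" by (rule K)
      also have "\<dots> \<le> (norm (y b - y a) + norm (c b - c a)) * K"
        using K(1) by (intro mult_right_mono norm_triangle_ineq4) simp
      also have "\<dots> \<le> (norm (y b - y a) + L * (b - a)) * K"
        using lipschitz_onD [OF L, of b a] ab K(1)
        by (intro mult_right_mono add_left_mono) (auto simp: dist_norm)
      also have "\<dots> = K * norm (y b - y a) + L * K * (b - a)" by (simp add: algebra_simps)
      finally show "norm (D b - D a) \<le> K * norm (y b - y a) + L * K * (b - a)" .
    qed

    \<comment> \<open>The exceptional null set of times\<close>
    define c1 where "c1 t = c (max 0 t)" for t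
    \<comment> \<open>Freezing \<open>c\<close> at its initial value for negative times keeps the
      Lipschitz constant and gives a function on the whole line, equal to \<open>c\<close> at
      positive times.\<close>
    have "L-lipschitz_on UNIV c1"
    proof (rule lipschitz_onI)
      fix s t :: real
      have "dist (c1 s) (c1 t) \<le> L * dist (max 0 s) (max 0 t)"
        unfolding c1_def by (rule lipschitz_onD [OF L]) auto
      also have "\<dots> \<le> L * dist s t"
        using \<open>L \<ge> 0\<close> by (intro mult_left_mono) (auto simp: dist_real_def)
      finally show "dist (c1 s) (c1 t) \<le> L * dist s t" .
    qed (rule \<open>L \<ge> 0\<close>)
    then have N1: "negligible {t. \<nexists>l. (c1 has_vector_derivative l) (at t)}"
      by (rule negligible_non_differentiable_lipschitz)
    let ?P = "\<lambda>t. 0 \<le> t \<longrightarrow> (\<exists>y'. (y has_vector_derivative y') (at t within {0..}) \<and>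
        - y' \<in> normal_cone V A ((+) (c t) ` C) (y t))"
    let ?Q = "\<lambda>t. t \<in> {0..\<tau>} \<longrightarrow> (\<forall>z\<in>F.
        (+) (- vector_derivative c (at t within {0..})) ` (ball_wrt V A \<epsilon> \<inter> normal_cone V A F z)
          \<subseteq> normal_cone V A C z)"
    have "AE t in lebesgue. ?P t" using sol by (simp add: sweeping_solution_def)
    then have "AE t in lebesgue. ?P t \<and> ?Q t" using cone by (rule AE_conjI)
    then obtain N2 where N2: "N2 \<in> null_sets lebesgue" "{t. \<not> (?P t \<and> ?Q t)} \<subseteq> N2"
      unfolding eventually_ae_filter by auto
    \<comment> \<open>Time 0 is excluded because the derivatives within \<open>{0..}\<close> are
      one-sided there; at positive times they are ordinary derivatives.\<close>
    define N where "N = insert 0 (N2 \<union> {t. \<nexists>l. (c1 has_vector_derivative l) (at t)})"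
    have N: "negligible N"
      using N1 N2(1) by (simp add: N_def negligible_iff_null_sets null_sets.Un)
    show "D \<tau> = 0"
    proof (rule vanishes_by_decay [OF acD N eps \<open>\<tau> \<ge> 0\<close>])
      show "D t \<ge> 0" for t by (simp add: D_def infdist_nonneg)
      obtain f where "f \<in> F" using F by blast
      have "D 0 \<le> dist (x 0) (B f)"
        unfolding D_def by (rule infdist_le) (simp add: G_def \<open>f \<in> F\<close>)
      also have "\<dots> = norm_wrt A ((y 0 - c 0) - f)" by (simp add: x_def norm_B B_diff dist_norm)
      also have "\<dots> \<le> M" using M(2) y_in [of 0] \<open>f \<in> F\<close> by blast
      finally show "D 0 \<le> \<epsilon> * \<tau>" using \<open>M \<le> \<epsilon> * \<tau>\<close> by linarith

      \<comment> \<open>The differential inequality for the distance\<close>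
      fix t assume t: "t \<in> {0..\<tau>} - N" and Dpos: "D t > 0"
      then have "t \<noteq> 0" "0 \<le> t" "t \<le> \<tau>" by (auto simp: N_def)
      then have "t > 0" by simp
      then have at: "at t within {0..} = at t" by (intro at_within_interior) simp
      have PQ: "?P t" "?Q t" using N2(2) t by (auto simp: N_def)
      obtain y' where y': "(y has_vector_derivative y') (at t)"
        and y'_cone: "- y' \<in> normal_cone V A ((+) (c t) ` C) (y t)"
        using PQ(1) \<open>t > 0\<close> unfolding at by auto
      obtain c' where "(c1 has_vector_derivative c') (at t)" using t by (auto simp: N_def)
      then have c': "(c has_vector_derivative c') (at t)"
        by (rule has_vector_derivative_transform_within_open [where S = "{0<..}"])
          (use \<open>t > 0\<close> in \<open>auto simp: c1_def\<close>)
      have vdc: "vector_derivative c (at t within {0..}) = c'"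
        using c' by (simp add: at vector_derivative_at)
      have cone_t: "- c' + n \<in> normal_cone V A C z"
        if "z \<in> F" "n \<in> ball_wrt V A \<epsilon>" "n \<in> normal_cone V A F z" for n z
        using PQ(2) that \<open>t > 0\<close> \<open>t \<le> \<tau>\<close> unfolding vdc by auto
      have x': "(x has_vector_derivative B (y' - c')) (at t)"
        unfolding x_def
        by (rule bounded_linear.has_vector_derivative [OF blB has_vector_derivative_diff [OF y' c']])
      define X where "X = y t - c t"
      have X: "X \<in> C" using y_in \<open>t > 0\<close> by (simp add: X_def)
      have "closest_point G (x t) \<in> G" using G by (simp add: closest_point_in_set)
      then obtain Z where Z: "Z \<in> F" "closest_point G (x t) = B Z" by (auto simp: G_def)
      define u where "u = X - Z"
      have Bu: "B u = x t - closest_point G (x t)"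
        unfolding Z(2) by (simp add: u_def X_def x_def B_diff)
      have nu: "norm (B u) = D t"
        using G by (simp add: D_def Bu infdist_eq_dist_closest_point dist_norm)
      \<comment> \<open>The vector \<open>u\<close> has length \<open>D t\<close> in the norm given
        by \<open>A\<close>; rescaled to length \<epsilon>, it is as long as the ball in the
        hypothesis allows.\<close>
      define n where "n = (\<epsilon> / D t) *\<^sub>R u"
      have "X \<in> V" "Z \<in> V" using X Z FC CV by auto
      then have "n \<in> V" unfolding n_def u_def by (intro subspace_scale subspace_diff V)
      have "n \<in> ball_wrt V A \<epsilon>"
        using \<open>n \<in> V\<close> Dpos eps by (simp add: ball_wrt_def norm_B n_def B_scale nu)
      moreover have "n \<in> normal_cone V A F Z"
      proof -
        have "n \<bullet> (A *v (\<xi> - Z)) \<le> 0" if "\<xi> \<in> F" for \<xi>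
        proof -
          have "B u \<bullet> (B \<xi> - B Z) \<le> 0"
            unfolding Bu Z(2) [symmetric] by (rule closest_point_dot) (use G that in \<open>auto simp: G_def\<close>)
          then have "(\<epsilon> / D t) * (B u \<bullet> (B \<xi> - B Z)) \<le> 0"
            using Dpos eps by (intro mult_nonneg_nonpos) simp_all
          then show ?thesis by (simp only: inner_B [symmetric] n_def B_scale B_diff inner_scaleR_left)
        qed
        then show ?thesis using Z(1) \<open>n \<in> V\<close> by (simp add: normal_cone_def)
      qed
      ultimately have "- c' + n \<in> normal_cone V A C Z" using Z(1) by (intro cone_t)
      then have "(- c' + n) \<bullet> (A *v (X - Z)) \<le> 0"
        using X unfolding normal_cone_def by (metis (mono_tags, lifting) empty_iff mem_Collect_eq)
      then have "B (- c' + n) \<bullet> B u \<le> 0" by (simp add: inner_B u_def)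
      then have "(\<epsilon> / D t) * (B u \<bullet> B u) \<le> B c' \<bullet> B u"
        unfolding B_add B_minus n_def B_scale by (simp add: inner_diff_left)
      then have 1: "\<epsilon> * D t \<le> B c' \<bullet> B u"
        using Dpos by (simp add: dot_square_norm nu power2_eq_square)
      have "c t + Z \<in> (+) (c t) ` C" using Z(1) FC by auto
      then have "(- y') \<bullet> (A *v ((c t + Z) - y t)) \<le> 0"
        using y'_cone unfolding normal_cone_def by (metis (mono_tags, lifting) empty_iff mem_Collect_eq)
      moreover have "(c t + Z) - y t = - u" by (simp add: u_def X_def)
      ultimately have "B (- y') \<bullet> B (- u) \<le> 0" by (simp only: inner_B)
      then have 2: "B y' \<bullet> B u \<le> 0" by (simp add: B_minus)
      have "(D has_real_derivative (B (y' - c') \<bullet> B u) / D t) (at t)"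
        unfolding D_def Bu by (rule infdist_has_real_derivative [OF G x']) (use Dpos in \<open>simp add: D_def\<close>)
      \<comment> \<open>The numerator is at most \<open>- \<epsilon> * D t\<close>: the motion of
        \<open>y\<close> contributes at most 0 by \<open>2\<close>, and subtracting that of
        \<open>c\<close> contributes the rest by \<open>1\<close>.\<close>
      moreover have "(B (y' - c') \<bullet> B u) / D t \<le> - \<epsilon>"
        using 1 2 Dpos by (simp add: B_diff inner_diff_left divide_le_eq)
      ultimately show "\<exists>f'. (D has_real_derivative f') (at t) \<and> f' \<le> - \<epsilon>" by blast
    qed
  qed
  \<comment> \<open>Distance zero means membership because \<open>G\<close> is closed; injectivity
    of \<open>B\<close> then brings the statement back to \<open>F\<close>.\<close>
  then have "x \<tau> \<in> G" using G by (simp add: D_def in_closed_iff_infdist_zero)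
  then have "y \<tau> - c \<tau> \<in> F"
    using \<open>inj B\<close> by (simp add: x_def G_def inj_image_mem_iff)
  then show ?thesis by (rule rev_image_eqI) simp
qed

end
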